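(* Let $a_1,\dots,a_m\in\mathbb{R}^n$, $\mathcal{F}(b)=\{x\in\mathbb{R}^n: a_i'x\le b_i,\ i=1,\dots,m\}$, and let $\mathcal{P}(z,b)=\arg\min\{\|z-x\|_2: x\in\mathcal{F}(b)\}$ be the metric (Euclidean) projection of $z\in\mathbb{R}^n$ on $\mathcal{F}(b)$. Let $(\overline z,\overline b)\in\mathbb{R}^n\times\mathbb{R}^m$ be such that the Slater constraint qualification holds at $\overline b$, and let $\overline x$ be the unique projection of $\overline z$ on $\mathcal{F}(\overline b)$. Then $\mathcal{P}$ has the Aubin property at $((\overline z,\overline b),\overline x)$, and $$\mathrm{lip}\,\mathcal{P}((\overline z,\overline b),\overline x)=\max_{D\in\mathcal{L}_{\overline z,\overline b}(\overline x)}\left\Vert\left(I_n-A_D'(A_DA_D')^{-1}A_D\ \middle|\ A_D'(A_DA_D')^{-1}\right)\right\Vert,$$ where $$\mathcal{L}_{\overline z,\overline b}(\overline x)=\left\{D\subset I_{\overline b}(\overline x): \{a_i,i\in D\}\text{ is linearly independent and }\overline z-\overline x\in\mathrm{cone}\{a_i,i\in D\}\right\}.$$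
   Context: Vectors are columns and the prime denotes transposition; $\|\cdot\|_2$ is the Euclidean norm. The space $\mathbb{R}^n$ of the variable $x$ carries an arbitrary norm $\|\cdot\|$ with dual norm $\|u\|_*=\max_{\|y\|\le1}|u'y|$; the parameter space carries $\|(z,b)\|=\max\{\|z\|_*,\|b\|_\infty\}$. (The projection itself is always defined with the Euclidean norm.) Distances $d$ are induced by these norms, $d(x,\emptyset)=+\infty$; $\mathcal{P}$ is regarded as a set-valued mapping, empty where $\mathcal{F}(b)=\emptyset$. The Slater constraint qualification holds at $\overline b$ if there is $y$ with $a_i'y<\overline b_i$ for all $i=1,\dots,m$. $I_{\overline b}(\overline x)=\{i: a_i'\overline x=\overline b_i\}$. $\mathrm{cone}\,X$ is the convex conical hull of $X$, containing the origin, with $\mathrm{cone}\,\emptyset=\{0_n\}$. Linear independence is that of the indexed family. $A_D$ is the matrix with rows $a_i'$, $i\in D$. $(B\mid C)$ denotes a partitioned matrix. Aubin property of $\mathcal{P}$ at $((\overline z,\overline b),\overline x)$: there are neighborhoods $U$ of $\overline x$, $V$ of $(\overline z,\overline b)$ and $\kappa\ge0$ with $d(x^2,\mathcal{P}(z^1,b^1))\le\kappa\,d((z^2,b^2),(z^1,b^1))$ whenever $(z^1,b^1),(z^2,b^2)\in V$, $x^2\in\mathcal{P}(z^2,b^2)\cap U$. The Lipschitz modulus $\mathrm{lip}\,\mathcal{P}((\overline z,\overline b),\overline x)$ is the infimum of all such $\kappa$ over all choices of neighborhoods. The norm of an $n\times(n+|D|)$ matrix $N$ is $\max\{\|N\binom{\alpha}{\beta}\|: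 \max\{\|\alpha\|_*,\|\beta\|_\infty\}=1,\ \alpha\in\mathbb{R}^n,\ \beta\in\mathbb{R}^D\}$. When $D=\emptyset$, the partitioned matrix is just $I_n$ (and there is no $\beta$). *)

theory Defs
  imports "HOL-Analysis.Analysis"
begin

text \<open>An arbitrary norm, given as a function rather than through the type class, since the
  class norm of \<^typ>\<open>real ^ 'n\<close> is the Euclidean one. On this finite-dimensional space every
  such norm induces the class topology.\<close>

definition is_norm :: "('a::real_vector \<Rightarrow> real) \<Rightarrow> bool" where
  "is_norm N \<longleftrightarrow>
     (\<forall>x. 0 \<le> N x) \<and> (\<forall>x. N x = 0 \<longleftrightarrow> x = 0) \<and>
     (\<forall>c x. N (c *\<^sub>R x) = \<bar>c\<bar> * N x) \<and> (\<forall>x y. N (x + y) \<le> N x + N y)"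

text \<open>The supremum is attained, by compactness of the unit ball of a norm.\<close>

definition dual_norm :: "(real ^ 'n \<Rightarrow> real) \<Rightarrow> real ^ 'n \<Rightarrow> real" where
  "dual_norm N u = (SUP y\<in>{y. N y \<le> 1}. \<bar>u \<bullet> y\<bar>)"

definition param_norm :: "(real ^ 'n \<Rightarrow> real) \<Rightarrow> (real ^ 'n) \<times> (real ^ 'm) \<Rightarrow> real" where
  "param_norm N = (\<lambda>(z, b). max (dual_norm N z) (infnorm b))"

definition feasible :: "('m \<Rightarrow> real ^ 'n) \<Rightarrow> real ^ 'm \<Rightarrow> (real ^ 'n) set" where
  "feasible a b = {x. \<forall>i. a i \<bullet> x \<le> b $ i}"

definition proj :: "('m \<Rightarrow> real ^ 'n) \<Rightarrow> (real ^ 'n) \<times> (real ^ 'm) \<Rightarrow> (real ^ 'n) set" where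
  "proj a = (\<lambda>(z, b). {x. is_arg_min (\<lambda>x. norm (z - x)) (\<lambda>x. x \<in> feasible a b) x})"

definition slater :: "('m \<Rightarrow> real ^ 'n) \<Rightarrow> real ^ 'm \<Rightarrow> bool" where
  "slater a b \<longleftrightarrow> (\<exists>y. \<forall>i. a i \<bullet> y < b $ i)"

definition active :: "('m \<Rightarrow> real ^ 'n) \<Rightarrow> real ^ 'm \<Rightarrow> real ^ 'n \<Rightarrow> 'm set" where
  "active a b x = {i. a i \<bullet> x = b $ i}"

text \<open>Distance to a set; the infimum over the empty set is \<open>\<infinity>\<close>.\<close>

definition dist_to :: "('a::real_vector \<Rightarrow> real) \<Rightarrow> 'a \<Rightarrow> 'a set \<Rightarrow> ereal" where
  "dist_to N x S = (INF y\<in>S. ereal (N (x - y)))"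

text \<open>\<open>\<kappa>\<close> is an Aubin constant of \<open>M\<close> at \<open>(p, x)\<close> for the distances induced by \<open>NP\<close> (on
  parameters) and \<open>NX\<close> (on values). A neighborhood is a set with the point in its interior.\<close>

definition aubin_constant ::
  "('p::real_normed_vector \<Rightarrow> real) \<Rightarrow> ('a::real_normed_vector \<Rightarrow> real) \<Rightarrow>
     ('p \<Rightarrow> 'a set) \<Rightarrow> 'p \<Rightarrow> 'a \<Rightarrow> real \<Rightarrow> bool" where
  "aubin_constant NP NX M p x \<kappa> \<longleftrightarrow>
     0 \<le> \<kappa> \<and>
     (\<exists>U V. x \<in> interior U \<and> p \<in> interior V \<and>
        (\<forall>p1\<in>V. \<forall>p2\<in>V. \<forall>x2 \<in> M p2 \<inter> U.
           dist_to NX x2 (M p1) \<le> ereal (\<kappa> * NP (p2 - p1))))"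

definition aubin_property ::
  "('p::real_normed_vector \<Rightarrow> real) \<Rightarrow> ('a::real_normed_vector \<Rightarrow> real) \<Rightarrow>
     ('p \<Rightarrow> 'a set) \<Rightarrow> 'p \<Rightarrow> 'a \<Rightarrow> bool" where
  "aubin_property NP NX M p x \<longleftrightarrow> (\<exists>\<kappa>. aubin_constant NP NX M p x \<kappa>)"

definition lip ::
  "('p::real_normed_vector \<Rightarrow> real) \<Rightarrow> ('a::real_normed_vector \<Rightarrow> real) \<Rightarrow>
     ('p \<Rightarrow> 'a set) \<Rightarrow> 'p \<Rightarrow> 'a \<Rightarrow> ereal" where
  "lip NP NX M p x = (INF \<kappa>\<in>{\<kappa>. aubin_constant NP NX M p x \<kappa>}. ereal \<kappa>)"

text \<open>Linear independence of an indexed family: a repeated vector makes the family dependent.\<close>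

definition family_independent :: "('m \<Rightarrow> 'a::real_vector) \<Rightarrow> 'm set \<Rightarrow> bool" where
  "family_independent a D \<longleftrightarrow> inj_on a D \<and> independent (a ` D)"

text \<open>The family \<open>\<L>\<close> of index sets. The library's convex cones contain the origin, and
  \<open>convex_cone hull {} = {0}\<close>.\<close>

definition index_sets ::
  "('m \<Rightarrow> real ^ 'n) \<Rightarrow> real ^ 'n \<Rightarrow> real ^ 'm \<Rightarrow> real ^ 'n \<Rightarrow> 'm set set" where
  "index_sets a z b x =
     {D. D \<subseteq> active a b x \<and> family_independent a D \<and> z - x \<in> convex_cone hull (a ` D)}"

text \<open>
  As \<open>D\<close> ranges over subsets of the finite type \<open>'m\<close>, vectors and matrices indexed by \<open>D\<close> are
  encoded by their extension by zero: \<open>\<real>\<^sup>D\<close> is the set of \<open>\<beta> :: real ^ 'm\<close> vanishing off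
  \<open>D\<close>, and a \<open>D \<times> D\<close> matrix is one over \<open>'m \<times> 'm\<close> vanishing off \<open>D \<times> D\<close>. Sums, products, transposes
  and the maximum norm commute with this extension. The inverse does not, so \<open>block_inv\<close> is the
  two-sided inverse relative to the identity \<open>block_id D\<close> of \<open>D \<times> D\<close> matrices.
\<close>

definition rows_mat :: "('m \<Rightarrow> real ^ 'n) \<Rightarrow> 'm set \<Rightarrow> real ^ 'n ^ 'm" where
  "rows_mat a D = (\<chi> i. if i \<in> D then a i else 0)"

definition block_id :: "'m set \<Rightarrow> real ^ 'm ^ 'm" where
  "block_id D = (\<chi> i j. if i = j \<and> i \<in> D then 1 else 0)"

definition block_inv :: "'m set \<Rightarrow> real ^ 'm ^ 'm \<Rightarrow> real ^ 'm ^ 'm" where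
  "block_inv D G =
     (THE H. (\<forall>i j. i \<notin> D \<or> j \<notin> D \<longrightarrow> H $ i $ j = 0) \<and>
             G ** H = block_id D \<and> H ** G = block_id D)"

definition hcat :: "real ^ 'k ^ 'n \<Rightarrow> real ^ 'm ^ 'n \<Rightarrow> real ^ ('k::finite + 'm::finite) ^ 'n" where
  "hcat B C = (\<chi> i j. case j of Inl k \<Rightarrow> B $ i $ k | Inr k \<Rightarrow> C $ i $ k)"

definition vstack :: "real ^ 'k \<Rightarrow> real ^ 'm \<Rightarrow> real ^ ('k::finite + 'm::finite)" where
  "vstack \<alpha> \<beta> = (\<chi> j. case j of Inl k \<Rightarrow> \<alpha> $ k | Inr k \<Rightarrow> \<beta> $ k)"

text \<open>Norm of an \<open>n \<times> (n + |D|)\<close> matrix; the supremum is attained. For \<open>D = {}\<close> the only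
  \<open>\<beta>\<close> is \<open>0\<close>.\<close>

definition part_mat_norm ::
  "(real ^ 'n \<Rightarrow> real) \<Rightarrow> 'm::finite set \<Rightarrow> real ^ ('n + 'm) ^ 'n \<Rightarrow> real" where
  "part_mat_norm N D B =
     Sup {N (B *v vstack \<alpha> \<beta>) | \<alpha> \<beta>.
            (\<forall>i. i \<notin> D \<longrightarrow> \<beta> $ i = 0) \<and> max (dual_norm N \<alpha>) (infnorm \<beta>) = 1}"

definition proj_mat :: "('m \<Rightarrow> real ^ 'n) \<Rightarrow> 'm::finite set \<Rightarrow> real ^ ('n + 'm) ^ 'n" where
  "proj_mat a D =
     (let A = rows_mat a D;
          R = transpose A ** block_inv D (A ** transpose A)
      in hcat (mat 1 - R ** A) R)"

end

theory Submission
  imports Defs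
begin

text \<open>On the closed set of parameters \<open>(z, b)\<close> where the projection satisfies the KKT conditions with
  multipliers supported on a linearly independent \<open>D\<close>, the projection is the linear map
  \<open>(z, b) \<mapsto> (I - A\<^sub>D'(A\<^sub>D A\<^sub>D')\<^sup>-\<^sup>1 A\<^sub>D) z + A\<^sub>D'(A\<^sub>D A\<^sub>D')\<^sup>-\<^sup>1 b\<^sub>D\<close>. By the conic Caratheodory theorem these finitely many
  closed regions cover all parameters with a nonempty feasible set, and near the reference point
  only regions with \<open>D\<close> in the family \<open>\<L>\<close> occur. A function on a segment that is covered by
  finitely many closed sets on each of which it is \<open>\<kappa>\<close>-Lipschitz is \<open>\<kappa>\<close>-Lipschitz, which gives the
  upper bound. Conversely, for every \<open>D\<close> in \<open>\<L>\<close> a small perturbation of the parameters moves into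
  the interior of its region, where the modulus is the norm of the linear map.\<close>

section \<open>Independence and conic hulls of finite indexed families\<close>

text \<open>Multipliers live on constraint indices, so independence is restated with coefficients on
  indices. If two indices carried the same vector, the coefficients 1 and -1 would give a nontrivial
  relation; this is why the right side forces injectivity.\<close>

lemma family_independent_iff:
  fixes a :: "'m::finite \<Rightarrow> 'a::real_vector"
  shows "family_independent a D \<longleftrightarrow> (\<forall>\<mu>. (\<Sum>i\<in>D. \<mu> i *\<^sub>R a i) = 0 \<longrightarrow> (\<forall>i\<in>D. \<mu> i = 0))"
    (is "_ \<longleftrightarrow> ?R")
proof
  assume L: "family_independent a D"
  then have inj: "inj_on a D" and ind: "independent (a ` D)"
    by (auto simp: family_independent_def)
  show ?R
  proof (intro allI impI ballI)
    fix \<mu> i assume 0: "(\<Sum>i\<in>D. \<mu> i *\<^sub>R a i) = 0" and i: "i \<in> D"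
    have "(\<Sum>v\<in>a ` D. \<mu> (the_inv_into D a v) *\<^sub>R v) = 0"
      using 0 by (simp add: sum.reindex[OF inj] the_inv_into_f_f[OF inj])
    then have "\<mu> (the_inv_into D a (a i)) = 0"
      using independentD[OF ind _ order_refl, of "\<lambda>v. \<mu> (the_inv_into D a v)" "a i"] i by simp
    then show "\<mu> i = 0" by (simp add: the_inv_into_f_f[OF inj i])
  qed
next
  assume R: ?R
  have inj: "inj_on a D"
  proof (rule inj_onI, rule ccontr)
    fix i j assume ij: "i \<in> D" "j \<in> D" "a i = a j" "i \<noteq> j"
    let ?\<mu> = "\<lambda>k. if k = i then 1 else if k = j then - 1 else (0::real)"
    have "(\<Sum>k\<in>D. ?\<mu> k *\<^sub>R a k) = (\<Sum>k\<in>{i, j}. ?\<mu> k *\<^sub>R a k)"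
      by (rule sum.mono_neutral_right) (use ij in auto)
    also have "\<dots> = 0" using ij by simp
    finally have "?\<mu> i = 0" using R[rule_format, of ?\<mu> i] ij by blast
    then show False by simp
  qed
  moreover have "independent (a ` D)"
  proof (rule independent_if_scalars_zero)
    fix f v assume "(\<Sum>x\<in>a ` D. f x *\<^sub>R x) = 0" "v \<in> a ` D"
    then show "f v = 0" using R[rule_format, of "f \<circ> a"] by (auto simp: sum.reindex[OF inj])
  qed simp
  ultimately show "family_independent a D" by (simp add: family_independent_def)
qed

text \<open>Membership in the cone becomes existence of nonnegative multipliers on \<open>D\<close>,
  the form in which the KKT conditions are used.\<close>

lemma convex_cone_hull_image:
  fixes a :: "'m::finite \<Rightarrow> 'a::real_vector"
  shows "convex_cone hull (a ` D) = {\<Sum>i\<in>D. \<mu> i *\<^sub>R a i |\<mu>. \<forall>i\<in>D. 0 \<le> \<mu> i}" (is "_ = ?C")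
proof
  have "a ` D \<subseteq> ?C"
  proof clarify
    fix i assume "i \<in> D"
    then show "\<exists>\<mu>. a i = (\<Sum>i\<in>D. \<mu> i *\<^sub>R a i) \<and> (\<forall>i\<in>D. 0 \<le> \<mu> i)"
      by (intro exI[of _ "\<lambda>k. if k = i then 1 else 0"])
        (simp add: if_distrib[of "\<lambda>c. c *\<^sub>R _"] sum.delta cong: if_cong)
  qed
  moreover have "convex_cone ?C"
    unfolding convex_cone_iff
  proof (intro conjI)
    show "0 \<in> ?C" by (auto intro: exI[of _ "\<lambda>_. 0"])
    show "\<forall>x\<in>?C. \<forall>y\<in>?C. x + y \<in> ?C"
    proof clarify
      fix \<mu> \<nu> :: "'m \<Rightarrow> real" assume "\<forall>i\<in>D. 0 \<le> \<mu> i" "\<forall>i\<in>D. 0 \<le> \<nu> i"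
      then show "\<exists>\<rho>. (\<Sum>i\<in>D. \<mu> i *\<^sub>R a i) + (\<Sum>i\<in>D. \<nu> i *\<^sub>R a i) = (\<Sum>i\<in>D. \<rho> i *\<^sub>R a i) \<and> (\<forall>i\<in>D. 0 \<le> \<rho> i)"
        by (intro exI[of _ "\<lambda>i. \<mu> i + \<nu> i"]) (simp add: scaleR_left_distrib sum.distrib)
    qed
    show "\<forall>x\<in>?C. \<forall>c\<ge>0. c *\<^sub>R x \<in> ?C"
    proof clarify
      fix \<mu> :: "'m \<Rightarrow> real" and c :: real assume "\<forall>i\<in>D. 0 \<le> \<mu> i" "c \<ge> 0"
      then show "\<exists>\<rho>. c *\<^sub>R (\<Sum>i\<in>D. \<mu> i *\<^sub>R a i) = (\<Sum>i\<in>D. \<rho> i *\<^sub>R a i) \<and> (\<forall>i\<in>D. 0 \<le> \<rho> i)"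
        by (intro exI[of _ "\<lambda>i. c * \<mu> i"]) (simp add: scaleR_right.sum)
    qed
  qed
  ultimately show "convex_cone hull (a ` D) \<subseteq> ?C" by (rule hull_minimal)
  show "?C \<subseteq> convex_cone hull (a ` D)"
  proof clarify
    fix \<mu> :: "'m \<Rightarrow> real" assume \<mu>: "\<forall>i\<in>D. 0 \<le> \<mu> i"
    have "finite D" by simp
    then show "(\<Sum>i\<in>D. \<mu> i *\<^sub>R a i) \<in> convex_cone hull (a ` D)"
      using \<mu>
    proof (induction D)
      case empty
      then show ?case by simp
    next
      case (insert j D)
      have "(\<Sum>i\<in>D. \<mu> i *\<^sub>R a i) \<in> convex_cone hull (a ` insert j D)"
        using insert hull_mono[of "a ` D" "a ` insert j D" convex_cone] by auto
      moreover have "\<mu> j *\<^sub>R a j \<in> convex_cone hull (a ` insert j D)"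
        using insert by (intro convex_cone_hull_mul hull_inc) auto
      ultimately show ?case using insert by (simp add: convex_cone_hull_add)
    qed
  qed
qed

lemma conic_caratheodory:
  fixes a :: "'m::finite \<Rightarrow> 'a::real_vector"
  assumes "v \<in> convex_cone hull (a ` D)"
  obtains E where "E \<subseteq> D" "family_independent a E" "v \<in> convex_cone hull (a ` E)"
proof -
  have "\<exists>E\<subseteq>D. family_independent a E \<and> v \<in> convex_cone hull (a ` E)"
    using assms
  proof (induction "card D" arbitrary: D rule: less_induct)
    case less
    from less.prems obtain l where l: "\<And>i. i \<in> D \<Longrightarrow> 0 \<le> l i" and v: "v = (\<Sum>i\<in>D. l i *\<^sub>R a i)"
      by (auto simp: convex_cone_hull_image)
    show ?case
    proof (cases "family_independent a D")
      case True
      then show ?thesis using less.prems by blast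
    next
      case False
      then obtain \<mu>0 k where 0: "(\<Sum>i\<in>D. \<mu>0 i *\<^sub>R a i) = 0" "k \<in> D" "\<mu>0 k \<noteq> 0"
        by (auto simp: family_independent_iff)
      \<comment> \<open>The sign is chosen so that some coefficient of the relation is positive,
        which makes the set \<open>P\<close> of the ratio test nonempty.\<close>
      define \<mu> where "\<mu> = (\<lambda>i. sgn (\<mu>0 k) * \<mu>0 i)"
      have \<mu>: "(\<Sum>i\<in>D. \<mu> i *\<^sub>R a i) = 0" "\<mu> k > 0"
      proof -
        have "(\<Sum>i\<in>D. \<mu> i *\<^sub>R a i) = sgn (\<mu>0 k) *\<^sub>R (\<Sum>i\<in>D. \<mu>0 i *\<^sub>R a i)"
          by (simp add: \<mu>_def scaleR_right.sum)
        then show "(\<Sum>i\<in>D. \<mu> i *\<^sub>R a i) = 0" using 0 by simp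
        show "\<mu> k > 0" using 0 by (auto simp: \<mu>_def sgn_if)
      qed
      define P where "P = {i \<in> D. \<mu> i > 0}"
      have "finite P" "P \<noteq> {}" using \<mu> 0 by (auto simp: P_def)
      then obtain j where j: "j \<in> P" "\<And>i. i \<in> P \<Longrightarrow> l j / \<mu> j \<le> l i / \<mu> i"
        using ex_is_arg_min_if_finite[of P "\<lambda>i. l i / \<mu> i"] by (auto simp: is_arg_min_linorder)
      \<comment> \<open>The minimal ratio is the largest step that keeps all coefficients
        nonnegative; at this step the coefficient of \<open>j\<close> is zero.\<close>
      define t where "t = l j / \<mu> j"
      have t: "t \<ge> 0" using j l by (auto simp: t_def P_def)
      define \<nu> where "\<nu> i = l i - t * \<mu> i" for i
      have nonneg: "0 \<le> \<nu> i" if "i \<in> D" for i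
      proof (cases "\<mu> i > 0")
        case True
        then have "t \<le> l i / \<mu> i" using that j by (auto simp: t_def P_def)
        then show ?thesis using True by (simp add: \<nu>_def field_simps)
      next
        case False
        then have "t * \<mu> i \<le> 0" using t by (simp add: mult_nonneg_nonpos)
        then show ?thesis using l[OF that] by (simp add: \<nu>_def)
      qed
      have "\<nu> j = 0" using j by (simp add: \<nu>_def t_def P_def)
      have "v = (\<Sum>i\<in>D. \<nu> i *\<^sub>R a i)"
      proof -
        have "(\<Sum>i\<in>D. \<nu> i *\<^sub>R a i) = v - t *\<^sub>R (\<Sum>i\<in>D. \<mu> i *\<^sub>R a i)"
          by (simp add: \<nu>_def v scaleR_left_diff_distrib sum_subtractf scaleR_right.sum)
        then show ?thesis using \<mu> by simp
      qed
      also have "\<dots> = (\<Sum>i\<in>D - {j}. \<nu> i *\<^sub>R a i)"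
        by (rule sum.mono_neutral_right) (use \<open>\<nu> j = 0\<close> in auto)
      finally have "v \<in> convex_cone hull (a ` (D - {j}))"
        unfolding convex_cone_hull_image using nonneg by blast
      moreover have "card (D - {j}) < card D"
        using j by (intro psubset_card_mono) (auto simp: P_def)
      ultimately show ?thesis using less.hyps[of "D - {j}"] by blast
    qed
  qed
  then show ?thesis using that by blast
qed

section \<open>Euclidean projection on a polyhedron and its KKT conditions\<close>

lemma closed_feasible: "closed (feasible a b)"
  unfolding feasible_def by (intro closed_Collect_all closed_Collect_le continuous_intros)

lemma convex_feasible: "convex (feasible a b)"
proof -
  have "feasible a b = (\<Inter>i. {x. a i \<bullet> x \<le> b $ i})" by (auto simp: feasible_def)
  then show ?thesis by (auto intro: convex_INT convex_halfspace_le)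
qed

lemma mem_proj_iff:
  "x \<in> proj a (z, b) \<longleftrightarrow> x \<in> feasible a b \<and> (\<forall>y\<in>feasible a b. dist z x \<le> dist z y)"
  by (auto simp: proj_def is_arg_min_linorder dist_norm)

lemma proj_unique: "x \<in> proj a (z, b) \<Longrightarrow> proj a (z, b) = {x}"
  using any_closest_point_unique[OF convex_feasible closed_feasible, of x a b _ z]
  unfolding set_eq_iff mem_proj_iff by blast

lemma proj_nonempty: "feasible a b \<noteq> {} \<Longrightarrow> proj a (z, b) \<noteq> {}"
  using closest_point_exists[OF closed_feasible, of a b z] mem_proj_iff by blast

text \<open>The constraints in \<open>D\<close> are equalities at \<open>x\<close>, so no feasible
  \<open>y\<close> increases any \<open>a i\<close> with \<open>i\<close> in \<open>D\<close>. Hence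
  \<open>z - x\<close> makes a nonpositive inner product with \<open>y - x\<close>, and expanding
  the squared distance from \<open>z\<close> to \<open>y\<close> shows that \<open>x\<close> is
  nearest.\<close>

lemma proj_if_kkt:
  fixes a :: "'m::finite \<Rightarrow> real ^ 'n"
  assumes F: "x \<in> feasible a b" and D: "\<And>i. i \<in> D \<Longrightarrow> a i \<bullet> x = b $ i"
    and C: "z - x \<in> convex_cone hull (a ` D)"
  shows "proj a (z, b) = {x}"
proof (rule proj_unique, unfold mem_proj_iff, intro conjI ballI F)
  fix y assume y: "y \<in> feasible a b"
  from C obtain \<mu> where \<mu>: "\<forall>i\<in>D. 0 \<le> \<mu> i" "z - x = (\<Sum>i\<in>D. \<mu> i *\<^sub>R a i)"
    by (auto simp: convex_cone_hull_image)
  have "(z - x) \<bullet> (y - x) = (\<Sum>i\<in>D. \<mu> i * (a i \<bullet> y - b $ i))"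
    unfolding \<mu>(2) inner_sum_left by (rule sum.cong) (simp_all add: inner_diff_right D right_diff_distrib)
  also have "\<dots> \<le> 0"
    using \<mu> y by (intro sum_nonpos mult_nonneg_nonpos) (auto simp: feasible_def)
  finally have "(z - x) \<bullet> (y - x) \<le> 0" .
  moreover have "(z - y) \<bullet> (z - y) = (z - x) \<bullet> (z - x) - 2 * ((z - x) \<bullet> (y - x)) + (y - x) \<bullet> (y - x)"
    by (simp add: algebra_simps inner_commute)
  ultimately have "(z - x) \<bullet> (z - x) \<le> (z - y) \<bullet> (z - y)"
    using inner_ge_zero[of "y - x"] by linarith
  then show "dist z x \<le> dist z y" by (simp add: dist_norm norm_le)
qed

text \<open>If \<open>z - x\<close> were outside the closed cone, a separating \<open>d\<close>
  would satisfy \<open>d \<bullet> (z - x) < 0\<close> and \<open>d \<bullet> a i \<ge> 0\<close> on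
  the active constraints. Then \<open>x - t d\<close> is feasible for small \<open>t > 0\<close>,
  and the obtuse angle property of the projection contradicts the first inequality.\<close>

lemma kkt_if_proj:
  fixes a :: "'m::finite \<Rightarrow> real ^ 'n"
  assumes x: "x \<in> proj a (z, b)"
  shows "z - x \<in> convex_cone hull (a ` active a b x)"
proof (rule ccontr)
  define C where "C = convex_cone hull (a ` active a b x)"
  assume "z - x \<notin> convex_cone hull (a ` active a b x)"
  moreover have "closed C" "convex C"
    unfolding C_def by (simp_all add: closed_convex_cone_hull convex_convex_cone_hull)
  ultimately obtain d \<gamma> where d: "d \<bullet> (z - x) < \<gamma>" "\<And>c. c \<in> C \<Longrightarrow> d \<bullet> c > \<gamma>"
    using separating_hyperplane_closed_point[of C "z - x"] by (auto simp: C_def)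
  have "\<gamma> < 0" using d(2)[of 0] by (simp add: C_def convex_cone_hull_contains_0)
  have pos: "d \<bullet> a i \<ge> 0" if i: "i \<in> active a b x" for i
  proof (rule ccontr)
    assume neg: "\<not> 0 \<le> d \<bullet> a i"
    \<comment> \<open>The multiple is chosen so that its inner product with \<open>d\<close> is
      exactly \<open>\<gamma>\<close>, which strict separation excludes.\<close>
    have "(\<gamma> / (d \<bullet> a i)) *\<^sub>R a i \<in> C"
      unfolding C_def using i neg \<open>\<gamma> < 0\<close>
      by (intro convex_cone_hull_mul hull_inc) (auto simp: divide_nonpos_neg)
    from d(2)[OF this] neg show False by simp
  qed
  have xF: "x \<in> feasible a b" and opt: "\<forall>y\<in>feasible a b. dist z x \<le> dist z y"
    using x by (auto simp: mem_proj_iff)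
  \<comment> \<open>Active constraints do not increase along \<open>-d\<close>; inactive ones have
    slack and survive a small step by continuity.\<close>
  have "\<forall>\<^sub>F t in at_right (0::real). a i \<bullet> (x - t *\<^sub>R d) \<le> b $ i" for i
  proof (cases "i \<in> active a b x")
    case True
    have "\<forall>\<^sub>F t in at_right (0::real). 0 < t" by (rule eventually_at_right_less)
    then show ?thesis
    proof eventually_elim
      case (elim t)
      have "a i \<bullet> (x - t *\<^sub>R d) = b $ i - t * (d \<bullet> a i)"
        using True by (simp add: active_def inner_diff_right inner_commute)
      then show ?case using elim pos[OF True] by simp
    qed
  next
    case False
    then have "a i \<bullet> x < b $ i" using xF by (auto simp: active_def feasible_def order.strict_iff_order)
    moreover have "((\<lambda>t. a i \<bullet> (x - t *\<^sub>R d)) \<longlongrightarrow> a i \<bullet> (x - 0 *\<^sub>R d)) (at_right (0::real))"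
      by (intro tendsto_intros)
    ultimately have "\<forall>\<^sub>F t in at_right (0::real). a i \<bullet> (x - t *\<^sub>R d) < b $ i"
      by (intro order_tendstoD) auto
    then show ?thesis by eventually_elim simp
  qed
  then have "\<forall>\<^sub>F t in at_right (0::real). x - t *\<^sub>R d \<in> feasible a b"
    unfolding feasible_def by (simp add: eventually_all_finite)
  moreover have "\<forall>\<^sub>F t in at_right (0::real). 0 < t" by (rule eventually_at_right_less)
  ultimately have "\<exists>t>0. x - t *\<^sub>R d \<in> feasible a b"
    using eventually_happens'[OF trivial_limit_at_right_real eventually_conj] by blast
  then obtain t where t: "t > 0" "x - t *\<^sub>R d \<in> feasible a b" by blast
  have "(z - x) \<bullet> ((x - t *\<^sub>R d) - x) \<le> 0"
    by (rule any_closest_point_dot[OF convex_feasible closed_feasible xF t(2) opt])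
  then have "0 \<le> d \<bullet> (z - x)" using t by (simp add: inner_commute zero_le_mult_iff)
  then show False using d \<open>\<gamma> < 0\<close> by linarith
qed

section \<open>Zero-extended matrices and the relative inverse of the Gram matrix\<close>

lemma rows_mat_mult_component: "(rows_mat a D *v x) $ i = (if i \<in> D then a i \<bullet> x else 0)"
  by (simp add: rows_mat_def matrix_vector_mult_def inner_vec_def)

lemma transpose_rows_mat_mult: "transpose (rows_mat a D) *v y = (\<Sum>i\<in>D. y $ i *\<^sub>R a i)"
proof -
  have "(transpose (rows_mat a D) *v y) $ k = (\<Sum>i\<in>UNIV. if i \<in> D then y $ i * a i $ k else 0)" for k
    unfolding transpose_def rows_mat_def matrix_vector_mult_def
    by (simp del: transpose_matrix_vector) (rule sum.cong, auto simp: mult.commute)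
  then show ?thesis
    by (simp add: vec_eq_iff sum.If_cases del: transpose_matrix_vector)
qed

lemma block_id_mult_component: "(block_id D *v x) $ i = (if i \<in> D then x $ i else 0)"
proof -
  have "(block_id D *v x) $ i = (\<Sum>j\<in>UNIV. if j = i then (if i \<in> D then x $ i else 0) else 0)"
    unfolding block_id_def matrix_vector_mult_def vec_lambda_beta by (rule sum.cong) auto
  then show ?thesis by simp
qed

lemma block_id_rows_mat: "block_id D ** rows_mat a D = rows_mat a D"
  by (simp add: matrix_eq matrix_vector_mul_assoc[symmetric] vec_eq_iff
      block_id_mult_component rows_mat_mult_component)

lemma transpose_block_id: "transpose (block_id D) = block_id D"
  by (auto simp: transpose_def block_id_def vec_eq_iff)

lemma block_id_mult_entry: "(block_id D ** H) $ i $ j = (if i \<in> D then H $ i $ j else 0)"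
proof -
  have "(block_id D ** H) $ i $ j = (\<Sum>k\<in>UNIV. if k = i then (if i \<in> D then H $ i $ j else 0) else 0)"
    unfolding block_id_def matrix_matrix_mult_def vec_lambda_beta by (rule sum.cong) auto
  then show ?thesis by simp
qed

lemma mult_block_id_entry: "(H ** block_id D) $ i $ j = (if j \<in> D then H $ i $ j else 0)"
proof -
  have "(H ** block_id D) $ i $ j = (\<Sum>k\<in>UNIV. if k = j then (if j \<in> D then H $ i $ j else 0) else 0)"
    unfolding block_id_def matrix_matrix_mult_def vec_lambda_beta by (rule sum.cong) auto
  then show ?thesis by simp
qed

text \<open>The support condition of \<open>block_inv\<close> becomes two matrix identities, so
  relative inverses can be handled by associativity.\<close>

lemma supported_iff_block_id:
  "(\<forall>i j. i \<notin> D \<or> j \<notin> D \<longrightarrow> H $ i $ j = 0) \<longleftrightarrow> block_id D ** H = H \<and> H ** block_id D = H"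
proof -
  have "block_id D ** H = H \<longleftrightarrow> (\<forall>i j. i \<notin> D \<longrightarrow> H $ i $ j = 0)"
    unfolding vec_eq_iff block_id_mult_entry by force
  moreover have "H ** block_id D = H \<longleftrightarrow> (\<forall>i j. j \<notin> D \<longrightarrow> H $ i $ j = 0)"
    unfolding vec_eq_iff mult_block_id_entry by force
  ultimately show ?thesis by blast
qed

definition gram :: "('m::finite \<Rightarrow> real ^ 'n) \<Rightarrow> 'm set \<Rightarrow> real ^ 'm ^ 'm" where
  "gram a D = rows_mat a D ** transpose (rows_mat a D)"

lemma block_id_gram: "block_id D ** gram a D = gram a D" "gram a D ** block_id D = gram a D"
proof -
  show "block_id D ** gram a D = gram a D"
    by (simp add: gram_def matrix_mul_assoc block_id_rows_mat)
  have "gram a D ** block_id D = rows_mat a D ** transpose (block_id D ** rows_mat a D)"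
    by (simp add: gram_def matrix_transpose_mul transpose_block_id matrix_mul_assoc)
  then show "gram a D ** block_id D = gram a D" by (simp add: block_id_rows_mat gram_def)
qed

lemma block_inv_unique:
  assumes H: "block_id D ** H = H" "H ** block_id D = H" "G ** H = block_id D" "H ** G = block_id D"
  shows "block_inv D G = H"
  unfolding block_inv_def supported_iff_block_id
proof (rule the_equality)
  fix K assume K: "(block_id D ** K = K \<and> K ** block_id D = K) \<and> G ** K = block_id D \<and> K ** G = block_id D"
  have "K = K ** (G ** H)" using K H by simp
  also have "\<dots> = H" using K H by (metis matrix_mul_assoc)
  finally show "K = H" .
qed (use H in simp)

lemma matrix_add_rdistrib:
  fixes A B :: "real ^ 'k ^ 'n"
  shows "(A + B) ** C = A ** C + B ** C"
  by (simp add: matrix_matrix_mult_def vec_eq_iff sum.distrib distrib_right)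

text \<open>The inverse of \<open>G + J\<close>, where \<open>J\<close> is the identity on the complement of \<open>D\<close>, is block
  diagonal with blocks \<open>block_inv D G\<close> and \<open>J\<close>.\<close>

lemma block_inv_gram:
  assumes ind: "family_independent a D"
  defines "H \<equiv> block_inv D (gram a D)"
  shows "block_id D ** H = H" "H ** block_id D = H" "gram a D ** H = block_id D" "H ** gram a D = block_id D"
proof -
  define G where "G = gram a D"
  define E where "E = block_id D"
  define J where "J = block_id (- D)"
  have EJ: "E + J = mat 1" "E ** J = 0" "J ** E = 0" "J ** J = J" "E ** E = E"
    unfolding E_def J_def vec_eq_iff block_id_mult_entry
    by (auto simp: block_id_def mat_def)
  have GE: "E ** G = G" "G ** E = G" by (simp_all add: E_def G_def block_id_gram)
  have GJ: "J ** G = 0" "G ** J = 0"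
    using EJ GE by (metis matrix_mul_assoc times0_left, metis matrix_mul_assoc times0_right)
  have "\<exists>M. M ** (G + J) = mat 1"
    unfolding matrix_left_invertible_ker
  proof (intro allI impI)
    fix v assume v: "(G + J) *v v = 0"
    have "J *v v = (J ** (G + J)) *v v"
      by (simp add: matrix_add_ldistrib GJ EJ)
    also have "\<dots> = 0" using v by (simp add: matrix_vector_mul_assoc[symmetric])
    finally have Jv: "J *v v = 0" .
    then have "G *v v = 0" using v by (simp add: matrix_vector_mult_add_rdistrib)
    \<comment> \<open>The quadratic form of the Gram matrix is the squared length of the combination
      of the \<open>a i\<close> with coefficients \<open>v\<close>, so independence kills the
      \<open>D\<close> part of \<open>v\<close>; \<open>J *v v = 0\<close> kills the rest.\<close>
    then have "0 = v \<bullet> (rows_mat a D *v (transpose (rows_mat a D) *v v))"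
      by (simp add: G_def gram_def matrix_vector_mul_assoc[symmetric])
    also have "\<dots> = (transpose (rows_mat a D) *v v) \<bullet> (transpose (rows_mat a D) *v v)"
      by (simp add: dot_lmul_matrix[symmetric])
    finally have "(\<Sum>i\<in>D. v $ i *\<^sub>R a i) = 0"
      by (metis inner_eq_zero_iff transpose_rows_mat_mult)
    then have "\<forall>i\<in>D. v $ i = 0" using ind[unfolded family_independent_iff] by blast
    moreover have "v $ i = 0" if "i \<notin> D" for i
      using arg_cong[OF Jv, of "\<lambda>u. u $ i"] that by (simp add: J_def block_id_mult_component)
    ultimately show "v = 0" by (auto simp: vec_eq_iff)
  qed
  then obtain M where M: "M ** (G + J) = mat 1" by blast
  then have M': "(G + J) ** M = mat 1" by (simp add: matrix_left_right_inverse)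
  \<comment> \<open>Multiplying \<open>M ** (G + J) = mat 1\<close> by \<open>J\<close> isolates the
    complementary block, because \<open>G\<close> and \<open>J\<close> annihilate each other.
    Subtracting that block leaves \<open>M ** G = E\<close>.\<close>
  have MJ: "M ** J = J"
    using arg_cong[OF M, of "\<lambda>X. X ** J"]
    by (simp add: matrix_mul_assoc[symmetric] matrix_add_rdistrib GJ EJ)
  have JM: "J ** M = J"
    using arg_cong[OF M', of "\<lambda>X. J ** X"]
    by (simp add: matrix_mul_assoc matrix_add_ldistrib GJ EJ)
  have MG: "M ** G = E" using M MJ EJ by (simp add: matrix_add_ldistrib) (metis add_right_cancel)
  have GM: "G ** M = E" using M' JM EJ by (simp add: matrix_add_rdistrib) (metis add_right_cancel)
  \<comment> \<open>Multiplication by \<open>E\<close> removes the identity block that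
    \<open>M\<close> has off \<open>D\<close>.\<close>
  define K where "K = M ** E"
  have ME: "M ** E = E ** M"
    by (metis GM MG matrix_mul_assoc)
  have "E ** K = K" "K ** E = K" "G ** K = E" "K ** G = E"
    using ME MG GM EJ GE unfolding K_def by (metis matrix_mul_assoc)+
  then have *: "block_id D ** K = K" "K ** block_id D = K" "gram a D ** K = block_id D" "K ** gram a D = block_id D"
    by (auto simp: E_def G_def)
  then have "H = K" unfolding H_def by (rule block_inv_unique)
  then show "block_id D ** H = H" "H ** block_id D = H" "gram a D ** H = block_id D" "H ** gram a D = block_id D"
    using * by simp_all
qed

section \<open>The linear pieces of the projection\<close>

text \<open>For independent \<open>D\<close> this is the Euclidean projection of \<open>z\<close> on
  the affine subspace where the constraints in \<open>D\<close> hold with equality.\<close>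

definition piece :: "('m::finite \<Rightarrow> real ^ 'n) \<Rightarrow> 'm set \<Rightarrow> (real ^ 'n) \<times> (real ^ 'm) \<Rightarrow> real ^ 'n" where
  "piece a D p = proj_mat a D *v vstack (fst p) (snd p)"

lemma hcat_vstack:
  fixes \<alpha> :: "real ^ 'k" and \<beta> :: "real ^ 'm"
  shows "hcat B C *v vstack \<alpha> \<beta> = B *v \<alpha> + C *v \<beta>"
proof -
  have "(\<Sum>j\<in>UNIV. f j) = (\<Sum>k\<in>UNIV. f (Inl k)) + (\<Sum>k\<in>UNIV. f (Inr k))"
    for f :: "'k + 'm \<Rightarrow> real"
    by (simp add: UNIV_Plus_UNIV[symmetric] sum.Plus del: UNIV_Plus_UNIV)
  then show ?thesis
    by (simp add: vec_eq_iff hcat_def vstack_def matrix_vector_mult_def)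
qed

lemma piece_eq:
  "piece a D (z, b) = z - transpose (rows_mat a D) *v (block_inv D (gram a D) *v (rows_mat a D *v z - b))"
  by (simp add: piece_def proj_mat_def Let_def hcat_vstack gram_def matrix_vector_mul_assoc[symmetric]
      matrix_vector_mult_diff_rdistrib matrix_vector_mult_diff_distrib del: transpose_matrix_vector)

lemma linear_piece: "linear (piece a D)"
proof -
  have *: "piece a D = (\<lambda>p. fst p - transpose (rows_mat a D) *v (block_inv D (gram a D) *v (rows_mat a D *v fst p - snd p)))"
    by (auto simp: fun_eq_iff piece_eq)
  show ?thesis
    unfolding * by (rule linearI)
      (simp_all add: matrix_vector_right_distrib matrix_vector_mult_diff_distrib algebra_simps
        matrix_vector_mult_scaleR del: transpose_matrix_vector)
qed

lemma piece_equality: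
  assumes ind: "family_independent a D" and i: "i \<in> D"
  shows "a i \<bullet> piece a D (z, b) = b $ i"
proof -
  let ?A = "rows_mat a D" and ?H = "block_inv D (gram a D)"
  have "?A *v (transpose ?A *v (?H *v w)) = (gram a D ** ?H) *v w" for w
    by (simp add: gram_def matrix_vector_mul_assoc matrix_mul_assoc del: transpose_matrix_vector)
  then have "?A *v piece a D (z, b) = ?A *v z - (gram a D ** ?H) *v (?A *v z - b)"
    unfolding piece_eq by (subst matrix_vector_mult_diff_distrib) simp
  also have "\<dots> = ?A *v z - block_id D *v (?A *v z - b)"
    using block_inv_gram[OF ind] by simp
  finally have "(?A *v piece a D (z, b)) $ i = (?A *v z - block_id D *v (?A *v z - b)) $ i"
    by simp
  then show ?thesis using i by (simp add: rows_mat_mult_component block_id_mult_component)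
qed

lemma piece_residual: "\<exists>\<mu>. z - piece a D (z, b) = (\<Sum>i\<in>D. \<mu> i *\<^sub>R a i)"
proof
  show "z - piece a D (z, b) =
      (\<Sum>i\<in>D. (block_inv D (gram a D) *v (rows_mat a D *v z - b)) $ i *\<^sub>R a i)"
    by (simp add: piece_eq transpose_rows_mat_mult del: transpose_matrix_vector)
qed

text \<open>Applying \<open>A\<close> to \<open>z - x = A' l\<close> gives the Gram matrix times
  \<open>l\<close>, while the equalities identify \<open>A x\<close> with \<open>b\<close> on
  \<open>D\<close>. The relative inverse thus recovers \<open>l\<close> from \<open>A z - b\<close>,
  and then \<open>x\<close> from \<open>z - A' l\<close>.\<close>

lemma piece_unique:
  assumes ind: "family_independent a D" and eq: "\<And>i. i \<in> D \<Longrightarrow> a i \<bullet> x = b $ i"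
    and res: "z - x = (\<Sum>i\<in>D. \<mu> i *\<^sub>R a i)"
  shows "piece a D (z, b) = x"
proof -
  let ?A = "rows_mat a D" and ?H = "block_inv D (gram a D)"
  define l where "l = (\<chi> i. if i \<in> D then \<mu> i else 0)"
  have zx: "z - x = transpose ?A *v l"
    by (simp add: transpose_rows_mat_mult l_def res del: transpose_matrix_vector)
  have Ax: "?A *v x = block_id D *v b"
    by (simp add: vec_eq_iff rows_mat_mult_component block_id_mult_component eq)
  have "?H *v b = ?H *v (block_id D *v b)"
    using block_inv_gram[OF ind] by (simp add: matrix_vector_mul_assoc)
  then have "?H *v (?A *v z - b) = ?H *v (?A *v (z - x))"
    using Ax by (simp add: matrix_vector_mult_diff_distrib)
  also have "\<dots> = (?H ** gram a D) *v l"
    by (simp add: zx gram_def matrix_vector_mul_assoc matrix_mul_assoc del: transpose_matrix_vector)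
  also have "\<dots> = block_id D *v l"
    using block_inv_gram[OF ind] by simp
  also have "\<dots> = l"
    by (simp add: vec_eq_iff block_id_mult_component l_def)
  finally show ?thesis using zx by (simp add: piece_eq algebra_simps del: transpose_matrix_vector)
qed

text \<open>This allows \<open>b\<close> to be replaced by its restriction to \<open>D\<close>, as
  the matrix norm ranges only over vectors supported there.\<close>

lemma piece_cong:
  assumes ind: "family_independent a D" and "\<And>i. i \<in> D \<Longrightarrow> b $ i = c $ i"
  shows "piece a D (z, b) = piece a D (z, c)"
proof -
  obtain \<mu> where "z - piece a D (z, c) = (\<Sum>i\<in>D. \<mu> i *\<^sub>R a i)" using piece_residual by blast
  then show ?thesis by (intro piece_unique[OF ind]) (simp_all add: assms piece_equality[OF ind])
qed

section \<open>Arbitrary norms, dual norms and the norm of a piece\<close>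

lemma is_normD:
  assumes "is_norm N"
  shows "0 \<le> N x" "N x = 0 \<longleftrightarrow> x = 0" "N (c *\<^sub>R x) = \<bar>c\<bar> * N x" "N (x + y) \<le> N x + N y"
  using assms by (auto simp: is_norm_def)

lemma is_norm_minus_commute:
  assumes "is_norm N"
  shows "N (x - y) = N (y - x)"
  using is_normD(3)[OF assms, of "- 1" "x - y"] by simp

lemma is_norm_triangle_diff:
  assumes "is_norm N"
  shows "\<bar>N x - N y\<bar> \<le> N (x - y)"
  using is_normD(4)[OF assms, of "x - y" y] is_normD(4)[OF assms, of "y - x" x]
    is_norm_minus_commute[OF assms, of x y] by simp

lemma is_norm_le_norm:
  fixes N :: "'a::euclidean_space \<Rightarrow> real"
  assumes N: "is_norm N"
  obtains C where "C > 0" "\<And>x. N x \<le> C * norm x"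
proof
  have sum: "N (\<Sum>b\<in>B. f b) \<le> (\<Sum>b\<in>B. N (f b))" if "finite B" for B :: "'a set" and f
    using that
  proof induction
    case empty
    then show ?case using is_normD(2)[OF N, of 0] by simp
  next
    case (insert b B)
    then show ?case using is_normD(4)[OF N, of "f b" "sum f B"] by simp
  qed
  show "N x \<le> ((\<Sum>b\<in>Basis. N b) + 1) * norm x" for x
  proof -
    have "N x = N (\<Sum>b\<in>Basis. (x \<bullet> b) *\<^sub>R b)" by (simp add: euclidean_representation)
    also have "\<dots> \<le> (\<Sum>b\<in>Basis. \<bar>x \<bullet> b\<bar> * N b)"
      using sum[of Basis "\<lambda>b. (x \<bullet> b) *\<^sub>R b"] by (simp add: is_normD(3)[OF N])
    also have "\<dots> \<le> (\<Sum>b\<in>Basis. norm x * N b)"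
      by (intro sum_mono mult_right_mono Basis_le_norm is_normD(1)[OF N])
    also have "\<dots> \<le> ((\<Sum>b\<in>Basis. N b) + 1) * norm x"
      unfolding sum_distrib_left[symmetric]
      by (subst mult.commute) (rule mult_right_mono, simp_all)
    finally show ?thesis .
  qed
  show "(\<Sum>b\<in>Basis. N b) + 1 > 0"
    using sum_nonneg[of Basis N] is_normD(1)[OF N] by force
qed

text \<open>\<open>N\<close> is continuous for the Euclidean topology, so it attains a minimum on
  the compact unit sphere. The minimum is positive, and homogeneity extends the bound to all
  vectors.\<close>

lemma norm_le_is_norm:
  fixes N :: "'a::euclidean_space \<Rightarrow> real"
  assumes N: "is_norm N"
  obtains C where "C > 0" "\<And>x. norm x \<le> C * N x"
proof -
  obtain C where C: "C > 0" "\<And>x. N x \<le> C * norm x" using is_norm_le_norm[OF N] by blast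
  have "lipschitz_on C UNIV N"
    using C is_norm_triangle_diff[OF N]
    by (intro lipschitz_onI) (auto simp: dist_norm intro: order_trans)
  then have "continuous_on (sphere 0 1) N"
    using lipschitz_on_continuous_on continuous_on_subset by blast
  moreover have "sphere (0::'a) 1 \<noteq> {}" by simp
  ultimately obtain u where u: "u \<in> sphere 0 1" "\<And>y. y \<in> sphere 0 1 \<Longrightarrow> N u \<le> N y"
    using continuous_attains_inf[OF compact_sphere] by blast
  have pos: "N u > 0" using u is_normD(1,2)[OF N, of u] by (auto simp: less_le)
  have "norm x \<le> (1 / N u) * N x" for x
  proof (cases "x = 0")
    case False
    then have "N u \<le> N ((1 / norm x) *\<^sub>R x)" by (intro u) simp
    then show ?thesis using False pos by (simp add: is_normD(3)[OF N] field_simps)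
  qed (simp add: is_normD(1)[OF N] pos)
  then show ?thesis using pos by (intro that[of "1 / N u"]) auto
qed

lemma abs_inner_le_dual_norm:
  assumes N: "is_norm N"
  shows "\<bar>u \<bullet> y\<bar> \<le> dual_norm N u * N y"
proof -
  obtain C where C: "C > 0" "\<And>x. norm x \<le> C * N x" using norm_le_is_norm[OF N] by blast
  \<comment> \<open>A real supremum is an upper bound only once the set is known to be bounded;
    equivalence of norms supplies this.\<close>
  have "bdd_above ((\<lambda>y. \<bar>u \<bullet> y\<bar>) ` {y. N y \<le> 1})"
  proof (rule bdd_aboveI2)
    fix y assume "y \<in> {y. N y \<le> 1}"
    then have "C * N y \<le> C * 1" using C(1) by (intro mult_left_mono) auto
    then have "norm y \<le> C" using C(2)[of y] by simp
    then show "\<bar>u \<bullet> y\<bar> \<le> norm u * C"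
      using Cauchy_Schwarz_ineq2[of u y] mult_left_mono[of "norm y" C "norm u"] by simp
  qed
  then have *: "\<bar>u \<bullet> y\<bar> \<le> dual_norm N u" if "N y \<le> 1" for y
    unfolding dual_norm_def using that by (intro cSUP_upper) auto
  show ?thesis
  proof (cases "y = 0")
    case False
    then have pos: "N y > 0" using is_normD(1,2)[OF N, of y] by (auto simp: less_le)
    have "\<bar>u \<bullet> ((1 / N y) *\<^sub>R y)\<bar> \<le> dual_norm N u"
      using pos by (intro *) (simp add: is_normD(3)[OF N])
    then show ?thesis using pos by (simp add: field_simps abs_mult)
  next
    case True
    then show ?thesis using is_normD(2)[OF N, of 0] by simp
  qed
qed

lemma dual_norm_nonneg:
  fixes u :: "real ^ 'n"
  assumes N: "is_norm N"
  shows "0 \<le> dual_norm N u"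
proof -
  obtain y :: "real ^ 'n" where "y \<noteq> 0" using nonzero_Basis nonempty_Basis by blast
  then have "N y > 0" using is_normD(1,2)[OF N, of y] by (auto simp: less_le)
  moreover have "0 \<le> dual_norm N u * N y" using abs_inner_le_dual_norm[OF N, of u y] by linarith
  ultimately show ?thesis by (simp add: zero_le_mult_iff)
qed

text \<open>The dual norm of \<open>u\<close> is tested against \<open>u\<close> itself.\<close>

lemma norm_le_dual_norm:
  fixes N :: "real ^ 'n \<Rightarrow> real"
  assumes N: "is_norm N"
  obtains C where "C > 0" "\<And>u. norm u \<le> C * dual_norm N u"
proof -
  obtain C where C: "C > 0" "\<And>x. N x \<le> C * norm x" using is_norm_le_norm[OF N] by blast
  have "norm u \<le> C * dual_norm N u" for u
  proof (cases "u = 0")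
    case False
    have "norm u * norm u \<le> dual_norm N u * N u"
      using abs_inner_le_dual_norm[OF N, of u u] by (simp add: dot_square_norm power2_eq_square)
    also have "\<dots> \<le> dual_norm N u * (C * norm u)"
      by (intro mult_left_mono C dual_norm_nonneg N)
    finally have "norm u * norm u \<le> (C * dual_norm N u) * norm u" by (simp add: mult_ac)
    then show ?thesis using False by simp
  qed (use C dual_norm_nonneg[OF N] in simp)
  then show ?thesis using C that by blast
qed

lemma dual_norm_scaleR:
  assumes N: "is_norm N"
  shows "dual_norm N (c *\<^sub>R u) = \<bar>c\<bar> * dual_norm N u"
proof -
  have le: "dual_norm N (c *\<^sub>R u) \<le> \<bar>c\<bar> * dual_norm N u" for c u
    unfolding dual_norm_def[of N "c *\<^sub>R u"]
  proof (rule cSUP_least)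
    show "{y. N y \<le> 1} \<noteq> {}" using is_normD(2)[OF N, of 0] by (auto intro: exI[of _ 0])
    fix y assume "y \<in> {y. N y \<le> 1}"
    then have "dual_norm N u * N y \<le> dual_norm N u"
      using dual_norm_nonneg[OF N, of u] mult_left_mono[of "N y" 1] by simp
    then have "\<bar>u \<bullet> y\<bar> \<le> dual_norm N u" using abs_inner_le_dual_norm[OF N, of u y] by simp
    then show "\<bar>c *\<^sub>R u \<bullet> y\<bar> \<le> \<bar>c\<bar> * dual_norm N u" by (simp add: abs_mult mult_left_mono)
  qed
  show ?thesis
  proof (cases "c = 0")
    case True
    then show ?thesis using le[of 0 u] dual_norm_nonneg[OF N, of 0] by simp
  next
    case False
    \<comment> \<open>The reverse inequality is the same bound with \<open>1 / c\<close> applied to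
      \<open>c u\<close>.\<close>
    then have "dual_norm N u \<le> (1 / \<bar>c\<bar>) * dual_norm N (c *\<^sub>R u)"
      using le[of "1 / c" "c *\<^sub>R u"] by simp
    then show ?thesis using le[of c u] False by (simp add: field_simps)
  qed
qed

lemma param_norm_nonneg: "is_norm N \<Longrightarrow> 0 \<le> param_norm N p"
  by (auto simp: param_norm_def infnorm_pos_le le_max_iff_disj split: prod.split)

lemma param_norm_scaleR: "is_norm N \<Longrightarrow> param_norm N (c *\<^sub>R p) = \<bar>c\<bar> * param_norm N p"
  by (cases p) (simp add: param_norm_def dual_norm_scaleR infnorm_mul max_mult_distrib_left)

lemma norm_le_param_norm:
  fixes N :: "real ^ 'n \<Rightarrow> real"
  assumes N: "is_norm N"
  obtains C where "C > 0" "\<And>p :: (real ^ 'n) \<times> (real ^ 'm). norm p \<le> C * param_norm N p"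
proof -
  obtain C where C: "C > 0" "\<And>u. norm u \<le> C * dual_norm N u" using norm_le_dual_norm[OF N] by blast
  define S where "S = sqrt DIM(real ^ 'm)"
  have "norm p \<le> (C + S) * param_norm N p" for p :: "(real ^ 'n) \<times> (real ^ 'm)"
  proof (cases p)
    case (Pair z b)
    have "norm p \<le> norm z + norm b" unfolding Pair by (rule norm_Pair_le)
    also have "\<dots> \<le> C * dual_norm N z + S * infnorm b"
      using C(2)[of z] norm_le_infnorm[of b] by (simp add: S_def)
    also have "\<dots> \<le> C * param_norm N p + S * param_norm N p"
      using C(1) by (intro add_mono mult_left_mono) (auto simp: S_def Pair param_norm_def)
    finally show ?thesis by (simp add: algebra_simps)
  qed
  moreover have "C + S > 0" using C(1) by (simp add: S_def add_pos_nonneg)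
  ultimately show ?thesis using that by blast
qed

lemma part_mat_norm_eq:
  "part_mat_norm N D (proj_mat a D) =
    Sup {N (piece a D (\<alpha>, \<beta>)) |\<alpha> \<beta>. (\<forall>i. i \<notin> D \<longrightarrow> \<beta> $ i = 0) \<and> param_norm N (\<alpha>, \<beta>) = 1}"
  by (simp add: part_mat_norm_def piece_def param_norm_def)

lemma part_mat_norm_le:
  fixes N :: "real ^ 'n \<Rightarrow> real" and a :: "'m::finite \<Rightarrow> real ^ 'n"
  assumes N: "is_norm N"
    and le: "\<And>\<alpha> \<beta>. \<lbrakk>\<forall>i. i \<notin> D \<longrightarrow> \<beta> $ i = 0; param_norm N (\<alpha>, \<beta>) = 1\<rbrakk> \<Longrightarrow> N (piece a D (\<alpha>, \<beta>)) \<le> \<kappa>"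
  shows "part_mat_norm N D (proj_mat a D) \<le> \<kappa>"
  unfolding part_mat_norm_eq
proof (rule cSup_least)
  obtain u :: "real ^ 'n" where u: "u \<noteq> 0" using nonzero_Basis nonempty_Basis by blast
  obtain C where C: "C > 0" "\<And>u. norm u \<le> C * dual_norm N u" using norm_le_dual_norm[OF N] by blast
  have "0 < C * dual_norm N u" using C(2)[of u] u by (metis order_less_le_trans zero_less_norm_iff)
  then have "dual_norm N u > 0" using C(1) by (simp add: zero_less_mult_iff)
  \<comment> \<open>A unit parameter with zero second component is admissible for every
    \<open>D\<close>, including the empty set, so the supremum is over a nonempty set.\<close>
  then have "param_norm N ((1 / dual_norm N u) *\<^sub>R u, 0 :: real ^ 'm) = 1"
    by (simp add: param_norm_def dual_norm_scaleR[OF N] infnorm_0)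
  then have "N (piece a D ((1 / dual_norm N u) *\<^sub>R u, 0)) \<in>
      {N (piece a D (\<alpha>, \<beta>)) |\<alpha> \<beta>. (\<forall>i. i \<notin> D \<longrightarrow> \<beta> $ i = 0) \<and> param_norm N (\<alpha>, \<beta>) = 1}"
    by (intro CollectI exI conjI refl) simp_all
  then show "{N (piece a D (\<alpha>, \<beta>)) |\<alpha> \<beta>. (\<forall>i. i \<notin> D \<longrightarrow> \<beta> $ i = 0) \<and> param_norm N (\<alpha>, \<beta>) = 1} \<noteq> {}"
    by blast
  show "r \<le> \<kappa>"
    if "r \<in> {N (piece a D (\<alpha>, \<beta>)) |\<alpha> \<beta>. (\<forall>i. i \<notin> D \<longrightarrow> \<beta> $ i = 0) \<and> param_norm N (\<alpha>, \<beta>) = 1}" for r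
    using that by (elim CollectE exE conjE) (simp add: le)
qed

lemma infnorm_mono:
  fixes x y :: "real ^ 'm"
  assumes "\<And>i. \<bar>x $ i\<bar> \<le> \<bar>y $ i\<bar>"
  shows "infnorm x \<le> infnorm y"
  unfolding infnorm_cart[of x]
  by (rule cSup_least) (auto intro: order_trans[OF assms component_le_infnorm_cart])

text \<open>Cutting \<open>b\<close> off outside \<open>D\<close> leaves the piece unchanged and
  does not increase the parameter norm; after that, normalization reduces the claim to the unit
  vectors in the definition of the matrix norm.\<close>

lemma piece_le_part_mat_norm:
  fixes N :: "real ^ 'n \<Rightarrow> real" and a :: "'m::finite \<Rightarrow> real ^ 'n"
  assumes N: "is_norm N" and ind: "family_independent a D"
  shows "N (piece a D p) \<le> part_mat_norm N D (proj_mat a D) * param_norm N p"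
    and "0 \<le> part_mat_norm N D (proj_mat a D)"
proof -
  let ?S = "{N (piece a D (\<alpha>, \<beta>)) |\<alpha> \<beta>. (\<forall>i. i \<notin> D \<longrightarrow> \<beta> $ i = 0) \<and> param_norm N (\<alpha>, \<beta>) = 1}"
  let ?K = "part_mat_norm N D (proj_mat a D)"
  obtain C1 where C1: "C1 > 0" "\<And>x. N x \<le> C1 * norm x" using is_norm_le_norm[OF N] by blast
  obtain C2 where C2: "C2 > 0" "\<And>p. norm (piece a D p) \<le> C2 * norm p"
    using linear_bounded_pos[OF linear_piece[of a D]] by (metis mult.commute)
  obtain C3 where C3: "C3 > 0" "\<And>p :: (real ^ 'n) \<times> (real ^ 'm). norm p \<le> C3 * param_norm N p"
    using norm_le_param_norm[OF N] by blast
  have "bdd_above ?S"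
  proof (rule bdd_aboveI, clarify)
    fix \<alpha> \<beta> assume 1: "param_norm N (\<alpha>, \<beta> :: real ^ 'm) = 1"
    have "N (piece a D (\<alpha>, \<beta>)) \<le> C1 * (C2 * norm (\<alpha>, \<beta>))"
      using C1 C2(2)[of "(\<alpha>, \<beta>)"] by (meson mult_left_mono order_less_imp_le order_trans)
    also have "\<dots> \<le> C1 * (C2 * C3)"
      using C1 C2 C3(2)[of "(\<alpha>, \<beta>)"] 1 by (intro mult_left_mono) auto
    finally show "N (piece a D (\<alpha>, \<beta>)) \<le> C1 * (C2 * C3)" .
  qed
  then have up: "N (piece a D (\<alpha>, \<beta>)) \<le> ?K"
    if "\<forall>i. i \<notin> D \<longrightarrow> \<beta> $ i = 0" "param_norm N (\<alpha>, \<beta>) = 1" for \<alpha> \<beta>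
    unfolding part_mat_norm_eq using that by (intro cSup_upper) blast+
  show nonneg: "0 \<le> ?K"
  proof (rule ccontr)
    assume neg: "\<not> 0 \<le> ?K"
    \<comment> \<open>A negative \<open>?K\<close> contradicts \<open>up\<close> for any admissible
      vector, so the premise of \<open>part_mat_norm_le\<close> holds vacuously and any smaller
      bound follows.\<close>
    have "?K \<le> ?K - 1"
    proof (rule part_mat_norm_le[OF N])
      fix \<alpha> and \<beta> :: "real ^ 'm" assume "\<forall>i. i \<notin> D \<longrightarrow> \<beta> $ i = 0" "param_norm N (\<alpha>, \<beta>) = 1"
      then have "N (piece a D (\<alpha>, \<beta>)) \<le> ?K" by (rule up)
      then show "N (piece a D (\<alpha>, \<beta>)) \<le> ?K - 1"
        using is_normD(1)[OF N, of "piece a D (\<alpha>, \<beta>)"] neg by linarith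
    qed
    then show False by simp
  qed
  show "N (piece a D p) \<le> ?K * param_norm N p"
  proof -
    obtain z b where p: "p = (z, b)" by fastforce
    define \<beta> where "\<beta> = (\<chi> i. if i \<in> D then b $ i else 0)"
    define r where "r = param_norm N (z, \<beta>)"
    have eq: "piece a D p = piece a D (z, \<beta>)"
      unfolding p by (rule piece_cong[OF ind]) (simp add: \<beta>_def)
    have "infnorm \<beta> \<le> infnorm b" by (rule infnorm_mono) (simp add: \<beta>_def)
    then have r: "r \<le> param_norm N p" by (auto simp: r_def p param_norm_def)
    have "r \<ge> 0" by (simp add: r_def param_norm_nonneg[OF N])
    show ?thesis
    proof (cases "r = 0")
      case True
      then have "norm (z, \<beta>) \<le> 0" using C3(2)[of "(z, \<beta>)"] by (simp add: r_def)
      then have "piece a D p = 0" using eq linear_0[OF linear_piece] by simp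
      then show ?thesis
        using is_normD(2)[OF N, of 0] nonneg param_norm_nonneg[OF N, of p] by simp
    next
      case False
      then have "r > 0" using \<open>r \<ge> 0\<close> by simp
      have "N (piece a D ((1 / r) *\<^sub>R z, (1 / r) *\<^sub>R \<beta>)) \<le> ?K"
      proof (rule up)
        show "\<forall>i. i \<notin> D \<longrightarrow> ((1 / r) *\<^sub>R \<beta>) $ i = 0" by (simp add: \<beta>_def)
        show "param_norm N ((1 / r) *\<^sub>R z, (1 / r) *\<^sub>R \<beta>) = 1"
          using param_norm_scaleR[OF N, of "1 / r" "(z, \<beta>)"] \<open>r > 0\<close> by (simp add: r_def)
      qed
      then have "N (piece a D (z, \<beta>)) / r \<le> ?K"
        using linear_scale[OF linear_piece, of a D "1 / r" "(z, \<beta>)"] \<open>r > 0\<close>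
        by (simp add: is_normD(3)[OF N])
      then have "N (piece a D p) \<le> ?K * r" using \<open>r > 0\<close> eq by (simp add: field_simps)
      also have "\<dots> \<le> ?K * param_norm N p" using r nonneg by (rule mult_left_mono)
      finally show ?thesis .
    qed
  qed
qed

section \<open>Regions on which the projection is linear\<close>

text \<open>These are the KKT conditions for the candidate \<open>piece a D p\<close>: primal
  feasibility and nonnegative multipliers. Complementary slackness is built in, since the piece
  satisfies the constraints in \<open>D\<close> with equality when \<open>D\<close> is
  independent.\<close>

definition region :: "('m::finite \<Rightarrow> real ^ 'n) \<Rightarrow> 'm set \<Rightarrow> ((real ^ 'n) \<times> (real ^ 'm)) set" where
  "region a D = {p. piece a D p \<in> feasible a (snd p) \<and> fst p - piece a D p \<in> convex_cone hull (a ` D)}"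

lemma closed_region: "closed (region a D)"
proof -
  have cont: "continuous_on UNIV (piece a D)" by (rule linear_continuous_on_compose[OF continuous_on_id linear_piece])
  have "region a D = {p. \<forall>i. a i \<bullet> piece a D p \<le> snd p $ i} \<inter>
      (\<lambda>p. fst p - piece a D p) -` (convex_cone hull (a ` D))"
    by (auto simp: region_def feasible_def)
  moreover have "closed {p. \<forall>i. a i \<bullet> piece a D p \<le> snd p $ i}"
    by (intro closed_Collect_all closed_Collect_le continuous_intros cont)
  moreover have "closed ((\<lambda>p. fst p - piece a D p) -` (convex_cone hull (a ` D)))"
    by (intro closed_vimage closed_convex_cone_hull continuous_intros cont) simp
  ultimately show ?thesis by (simp add: closed_Int)
qed

lemma proj_on_region:
  assumes "family_independent a D" "p \<in> region a D"
  shows "proj a p = {piece a D p}"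
proof (cases p)
  case (Pair z b)
  show ?thesis
    unfolding Pair
  proof (rule proj_if_kkt)
    show "piece a D (z, b) \<in> feasible a b" "z - piece a D (z, b) \<in> convex_cone hull (a ` D)"
      using assms(2) by (simp_all add: Pair region_def)
  qed (rule piece_equality[OF assms(1)])
qed

text \<open>The multipliers of the projection are thinned out to an independent subset of the active
  constraints; uniqueness then identifies the corresponding piece with the projection.\<close>

lemma region_cover:
  fixes a :: "'m::finite \<Rightarrow> real ^ 'n"
  assumes "feasible a (snd p) \<noteq> {}"
  obtains D where "family_independent a D" "p \<in> region a D"
proof -
  obtain z b where p: "p = (z, b)" by fastforce
  obtain x where x: "x \<in> proj a (z, b)" using proj_nonempty assms p by fastforce
  obtain D where D: "D \<subseteq> active a b x" "family_independent a D" "z - x \<in> convex_cone hull (a ` D)"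
    using conic_caratheodory[OF kkt_if_proj[OF x]] by blast
  obtain \<mu> where "z - x = (\<Sum>i\<in>D. \<mu> i *\<^sub>R a i)"
    using D(3) by (auto simp: convex_cone_hull_image)
  then have "piece a D (z, b) = x"
    using D by (intro piece_unique) (auto simp: active_def)
  then show ?thesis using that D x by (auto simp: region_def p mem_proj_iff)
qed

text \<open>Consequently the closed regions of independent sets outside the family miss the
  reference point, and so do not meet some neighborhood of it.\<close>

lemma region_imp_index_set:
  assumes "family_independent a D" "(z, b) \<in> region a D" "proj a (z, b) = {x}"
  shows "D \<in> index_sets a z b x"
proof -
  have x: "x = piece a D (z, b)" using proj_on_region[OF assms(1,2)] assms(3) by simp
  have "D \<subseteq> active a b x" unfolding x active_def using piece_equality[OF assms(1)] by blast
  then show ?thesis using assms(1,2) by (simp add: index_sets_def region_def x[symmetric])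
qed

section \<open>Upper and lower bounds for the Lipschitz modulus\<close>

text \<open>Each piece has constant at most \<open>K\<close> on its own region. Along a segment the
  constants of finitely many closed pieces glue together without loss.\<close>

lemma proj_lipschitz_on_segment:
  fixes N :: "real ^ 'n \<Rightarrow> real" and a :: "'m::finite \<Rightarrow> real ^ 'n"
  assumes N: "is_norm N" and K: "0 \<le> K"
    and \<D>: "\<And>D. D \<in> \<D> \<Longrightarrow> family_independent a D \<and> part_mat_norm N D (proj_mat a D) \<le> K"
    and cover: "closed_segment p q \<subseteq> (\<Union>D\<in>\<D>. region a D)"
    and x: "proj a p = {x}" and y: "proj a q = {y}"
  shows "N (y - x) \<le> K * param_norm N (q - p)"
proof -
  define r where "r t = p + t *\<^sub>R (q - p)" for t :: real
  define f where "f t = the_elem (proj a (r t))" for t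
  define U where "U D = {0..1} \<inter> r -` region a D" for D
  define L where "L = K * param_norm N (q - p)"
  have L: "L \<ge> 0" unfolding L_def by (intro mult_nonneg_nonneg K param_norm_nonneg N)
  \<comment> \<open>\<open>lipschitz_on\<close> refers to the class metric, so the gluing is done
    for the real function \<open>N (f t - x)\<close>. As \<open>f 0 = x\<close> and
    \<open>f 1 = y\<close>, its increment over the unit interval is exactly
    \<open>N (y - x)\<close>.\<close>
  have "lipschitz_on L (U D) (\<lambda>t. N (f t - x))" if D: "D \<in> \<D>" for D
  proof (rule lipschitz_onI[OF _ L])
    fix s t assume st: "s \<in> U D" "t \<in> U D"
    have ind: "family_independent a D" using \<D>[OF D] by blast
    have f: "f s = piece a D (r s)" "f t = piece a D (r t)"
      using st by (simp_all add: f_def U_def proj_on_region[OF ind])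
    have "f s - f t = piece a D (r s - r t)" by (simp add: f linear_diff[OF linear_piece])
    also have "r s - r t = (s - t) *\<^sub>R (q - p)" by (simp add: r_def algebra_simps)
    finally have "N (f s - f t) \<le> part_mat_norm N D (proj_mat a D) * param_norm N ((s - t) *\<^sub>R (q - p))"
      by (simp add: piece_le_part_mat_norm[OF N ind])
    also have "\<dots> \<le> K * param_norm N ((s - t) *\<^sub>R (q - p))"
      using \<D>[OF D] by (intro mult_right_mono param_norm_nonneg N) blast
    also have "\<dots> = L * dist s t"
      by (simp add: param_norm_scaleR[OF N] L_def dist_norm)
    finally have "N (f s - f t) \<le> L * dist s t" .
    then show "dist (N (f s - x)) (N (f t - x)) \<le> L * dist s t"
      using is_norm_triangle_diff[OF N, of "f s - x" "f t - x"] by (simp add: dist_norm)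
  qed
  moreover have "closed (U D)" for D
    unfolding U_def r_def
    by (intro closed_Int closed_vimage closed_region continuous_intros)
  moreover have "{0..1} \<subseteq> (\<Union>D\<in>\<D>. U D)"
  proof
    fix t :: real assume t: "t \<in> {0..1}"
    then have "r t \<in> closed_segment p q"
      by (auto simp: r_def closed_segment_def algebra_simps intro!: exI[of _ t])
    then show "t \<in> (\<Union>D\<in>\<D>. U D)" using cover t by (auto simp: U_def)
  qed
  ultimately have "lipschitz_on L {0..1} (\<lambda>t. N (f t - x))"
    using L by (intro lipschitz_on_closed_Union[where U = U and I = \<D>]) auto
  then have "dist (N (f 1 - x)) (N (f 0 - x)) \<le> L * dist (1::real) 0"
    by (rule lipschitz_onD) auto
  moreover have "f 1 = y" "f 0 = x" by (simp_all add: f_def r_def x y)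
  ultimately show ?thesis using is_normD(2)[OF N, of 0] by (simp add: L_def dist_norm)
qed

text \<open>Adding \<open>\<epsilon> a\<^sub>i\<close> to \<open>z\<close> for \<open>i \<in> D\<close> makes the multipliers on \<open>D\<close> positive, and relaxing the other
  constraints by \<open>\<epsilon>\<close> makes them inactive, while the projection stays at \<open>x\<close>.\<close>

lemma perturbation_in_region:
  fixes a :: "'m::finite \<Rightarrow> real ^ 'n"
  assumes F: "x \<in> feasible a b" and D: "D \<in> index_sets a z b x" and \<epsilon>: "\<epsilon> > 0"
  defines "p \<equiv> (z, b) + \<epsilon> *\<^sub>R (\<Sum>i\<in>D. a i, \<chi> i. if i \<in> D then 0 else 1)"
  shows "piece a D p = x" "\<forall>\<^sub>F t in at_right 0. p + t *\<^sub>R v \<in> region a D" "p \<in> region a D"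
proof -
  obtain zp bp where p: "p = (zp, bp)" by fastforce
  have zp: "zp = z + \<epsilon> *\<^sub>R (\<Sum>i\<in>D. a i)" and bp: "bp $ i = b $ i + (if i \<in> D then 0 else \<epsilon>)" for i
    using p by (auto simp: p_def)
  have ind: "family_independent a D" and act: "D \<subseteq> active a b x"
    and C: "z - x \<in> convex_cone hull (a ` D)"
    using D by (auto simp: index_sets_def)
  obtain l where l: "\<forall>i\<in>D. 0 \<le> l i" "z - x = (\<Sum>i\<in>D. l i *\<^sub>R a i)"
    using C by (auto simp: convex_cone_hull_image)
  have res: "zp - x = (\<Sum>i\<in>D. (l i + \<epsilon>) *\<^sub>R a i)"
  proof -
    have "zp - x = (z - x) + \<epsilon> *\<^sub>R (\<Sum>i\<in>D. a i)" by (simp add: zp)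
    then show ?thesis by (simp add: l scaleR_left_distrib sum.distrib scaleR_right.sum)
  qed
  show px: "piece a D p = x"
    unfolding p using act res by (intro piece_unique[OF ind]) (auto simp: bp active_def)
  have ev: "\<forall>\<^sub>F t in at_right 0. p + t *\<^sub>R v \<in> region a D" for v
  proof -
    obtain \<alpha> \<beta> where v: "v = (\<alpha>, \<beta>)" by fastforce
    define d where "d = piece a D v"
    obtain \<mu> where \<mu>: "\<alpha> - d = (\<Sum>i\<in>D. \<mu> i *\<^sub>R a i)"
      using piece_residual unfolding d_def v by blast
    have piece_t: "piece a D (p + t *\<^sub>R v) = x + t *\<^sub>R d" for t
      by (simp add: linear_add[OF linear_piece] linear_scale[OF linear_piece] px d_def)
    \<comment> \<open>The \<open>\<mu> i\<close> may have any sign, but the margin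
      \<open>\<epsilon>\<close> dominates \<open>t * \<mu> i\<close> for small \<open>t\<close>. The
      slack \<open>\<epsilon>\<close> does the same for the constraints outside
      \<open>D\<close>.\<close>
    have "\<forall>\<^sub>F t in at_right 0. \<forall>i\<in>D. 0 < l i + \<epsilon> + t * \<mu> i"
    proof (intro eventually_ball_finite ballI)
      fix i assume i: "i \<in> D"
      have "((\<lambda>t. l i + \<epsilon> + t * \<mu> i) \<longlongrightarrow> l i + \<epsilon> + 0 * \<mu> i) (at_right 0)"
        by (intro tendsto_intros)
      moreover have "0 < l i + \<epsilon>" using l i \<epsilon> by (simp add: add_nonneg_pos)
      ultimately show "\<forall>\<^sub>F t in at_right 0. 0 < l i + \<epsilon> + t * \<mu> i"
        by (intro order_tendstoD) auto
    qed simp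
    moreover have "\<forall>\<^sub>F t in at_right 0. \<forall>i\<in>- D. a i \<bullet> (x + t *\<^sub>R d) < bp $ i + t * \<beta> $ i"
    proof (intro eventually_ball_finite ballI)
      fix i assume i: "i \<in> - D"
      have "((\<lambda>t. bp $ i + t * \<beta> $ i - a i \<bullet> (x + t *\<^sub>R d)) \<longlongrightarrow> bp $ i + 0 * \<beta> $ i - a i \<bullet> (x + 0 *\<^sub>R d)) (at_right 0)"
        by (intro tendsto_intros)
      moreover have "0 < bp $ i - a i \<bullet> x"
        using i F \<epsilon> by (auto simp: bp feasible_def intro: add_le_less_mono[of _ _ 0 \<epsilon>, simplified])
      ultimately have "\<forall>\<^sub>F t in at_right 0. 0 < bp $ i + t * \<beta> $ i - a i \<bullet> (x + t *\<^sub>R d)"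
        by (intro order_tendstoD) auto
      then show "\<forall>\<^sub>F t in at_right 0. a i \<bullet> (x + t *\<^sub>R d) < bp $ i + t * \<beta> $ i"
        by eventually_elim simp
    qed simp
    ultimately show ?thesis
    proof eventually_elim
      case (elim t)
      have "a i \<bullet> piece a D (p + t *\<^sub>R v) \<le> snd (p + t *\<^sub>R v) $ i" for i
      proof (cases "i \<in> D")
        case True
        then show ?thesis
          using piece_equality[OF ind, of i "fst (p + t *\<^sub>R v)" "snd (p + t *\<^sub>R v)"]
          by (simp only: prod.collapse order_refl)
      next
        case False
        then show ?thesis unfolding piece_t using elim(2) by (simp add: p v less_imp_le)
      qed
      moreover have "fst (p + t *\<^sub>R v) - piece a D (p + t *\<^sub>R v) = (\<Sum>i\<in>D. (l i + \<epsilon> + t * \<mu> i) *\<^sub>R a i)"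
      proof -
        have "fst (p + t *\<^sub>R v) - piece a D (p + t *\<^sub>R v) = (zp - x) + t *\<^sub>R (\<alpha> - d)"
          unfolding piece_t by (simp add: p v algebra_simps)
        then show ?thesis
          by (simp add: res \<mu> scaleR_left_distrib sum.distrib scaleR_right.sum)
      qed
      ultimately show ?case
        unfolding region_def convex_cone_hull_image feasible_def mem_Collect_eq
        using elim(1) by (intro conjI allI exI[of _ "\<lambda>i. l i + \<epsilon> + t * \<mu> i"]) (simp_all add: less_imp_le)
    qed
  qed
  show "\<forall>\<^sub>F t in at_right 0. p + t *\<^sub>R v \<in> region a D" by (rule ev)
  \<comment> \<open>In the direction 0 the eventual statement is constant in
    \<open>t\<close>.\<close>
  show "p \<in> region a D"
    using eventually_happens'[OF trivial_limit_at_right_real ev[of 0]] by simp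
qed

text \<open>Arbitrarily close to the reference point there is a \<open>p\<close> that also projects
  to \<open>x\<close> and from which a short step in the direction \<open>v\<close> stays in the
  region of \<open>D\<close>. There the projection moves by exactly \<open>t\<close> times the piece
  of \<open>v\<close>, so the Aubin estimate between \<open>p\<close> and \<open>p + t v\<close>
  bounds that piece.\<close>

lemma part_mat_norm_le_aubin_constant:
  fixes N :: "real ^ 'n \<Rightarrow> real" and a :: "'m::finite \<Rightarrow> real ^ 'n"
  assumes N: "is_norm N" and F: "x \<in> feasible a b" and D: "D \<in> index_sets a z b x"
    and \<kappa>: "aubin_constant (param_norm N) N (proj a) (z, b) x \<kappa>"
  shows "part_mat_norm N D (proj_mat a D) \<le> \<kappa>"
proof (rule part_mat_norm_le[OF N])
  fix \<alpha> and \<beta> :: "real ^ 'm" assume 1: "param_norm N (\<alpha>, \<beta>) = 1"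
  define v where "v = (\<alpha>, \<beta>)"
  define w where "w = (\<Sum>i\<in>D. a i, \<chi> i. if i \<in> D then 0 else (1 :: real))"
  have ind: "family_independent a D" using D by (auto simp: index_sets_def)
  obtain U V where UV: "x \<in> interior U" "(z, b) \<in> interior V"
    "\<And>p1 p2 x2. \<lbrakk>p1 \<in> V; p2 \<in> V; x2 \<in> proj a p2; x2 \<in> U\<rbrakk> \<Longrightarrow>
      dist_to N x2 (proj a p1) \<le> ereal (\<kappa> * param_norm N (p2 - p1))"
    using \<kappa> unfolding aubin_constant_def by blast
  have "((\<lambda>\<epsilon>. (z, b) + \<epsilon> *\<^sub>R w) \<longlongrightarrow> (z, b) + 0 *\<^sub>R w) (at_right 0)"
    by (intro tendsto_intros)
  then have "\<forall>\<^sub>F \<epsilon> in at_right 0. (z, b) + \<epsilon> *\<^sub>R w \<in> interior V"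
    using UV(2) by (intro topological_tendstoD) auto
  moreover have "\<forall>\<^sub>F \<epsilon> in at_right (0::real). 0 < \<epsilon>" by (rule eventually_at_right_less)
  ultimately have "\<exists>\<epsilon>>0. (z, b) + \<epsilon> *\<^sub>R w \<in> interior V"
    using eventually_happens'[OF trivial_limit_at_right_real eventually_conj] by blast
  then obtain \<epsilon> where \<epsilon>: "\<epsilon> > 0" "(z, b) + \<epsilon> *\<^sub>R w \<in> interior V" by blast
  define p where "p = (z, b) + \<epsilon> *\<^sub>R w"
  have p: "piece a D p = x" "\<forall>\<^sub>F t in at_right 0. p + t *\<^sub>R v \<in> region a D" "p \<in> region a D"
    unfolding p_def w_def by (rule perturbation_in_region[OF F D \<epsilon>(1)])+
  have pV: "p \<in> interior V" using \<epsilon> by (simp add: p_def)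
  have "((\<lambda>t. p + t *\<^sub>R v) \<longlongrightarrow> p + 0 *\<^sub>R v) (at_right 0)"
    by (intro tendsto_intros)
  then have "\<forall>\<^sub>F t in at_right 0. p + t *\<^sub>R v \<in> interior V"
    using pV by (intro topological_tendstoD) auto
  moreover have "((\<lambda>t. x + t *\<^sub>R piece a D v) \<longlongrightarrow> x + 0 *\<^sub>R piece a D v) (at_right 0)"
    by (intro tendsto_intros)
  then have "\<forall>\<^sub>F t in at_right 0. x + t *\<^sub>R piece a D v \<in> interior U"
    using UV(1) by (intro topological_tendstoD) auto
  moreover note p(2)
  moreover have "\<forall>\<^sub>F t in at_right (0::real). 0 < t" by (rule eventually_at_right_less)
  ultimately have "\<forall>\<^sub>F t in at_right (0::real). N (piece a D v) \<le> \<kappa>"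
  proof eventually_elim
    case (elim t)
    have "piece a D (p + t *\<^sub>R v) = x + t *\<^sub>R piece a D v"
      by (simp add: linear_add[OF linear_piece] linear_scale[OF linear_piece] p(1))
    then have "proj a (p + t *\<^sub>R v) = {x + t *\<^sub>R piece a D v}"
      using proj_on_region[OF ind elim(3)] by simp
    moreover have "proj a p = {x}" using proj_on_region[OF ind p(3)] p(1) by simp
    moreover have "p \<in> V" "p + t *\<^sub>R v \<in> V" "x + t *\<^sub>R piece a D v \<in> U"
      using pV elim interior_subset by blast+
    ultimately have "dist_to N (x + t *\<^sub>R piece a D v) {x} \<le> ereal (\<kappa> * param_norm N (t *\<^sub>R v))"
      using UV(3)[of p "p + t *\<^sub>R v" "x + t *\<^sub>R piece a D v"] by simp
    \<comment> \<open>As \<open>v\<close> is a unit parameter, \<open>t\<close> occurs linearly on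
      both sides of the estimate and cancels.\<close>
    moreover have "param_norm N (t *\<^sub>R v) = t"
      unfolding param_norm_scaleR[OF N] using elim(4) 1 by (simp add: v_def)
    ultimately have "t * N (piece a D v) \<le> t * \<kappa>"
      using elim(4) by (simp add: dist_to_def is_normD(3)[OF N] mult.commute)
    then show ?case using elim by simp
  qed
  then show "N (piece a D (\<alpha>, \<beta>)) \<le> \<kappa>"
    using eventually_happens'[OF trivial_limit_at_right_real] by (auto simp: v_def)
qed

text \<open>On a small ball around the reference point the regions of the family cover all
  parameters. The ball is convex, so the segment estimate applies to any two of its points.\<close>

lemma aubin_constant_proj:
  fixes N :: "real ^ 'n \<Rightarrow> real" and a :: "'m::finite \<Rightarrow> real ^ 'n"
  assumes N: "is_norm N" and "slater a b" and x: "proj a (z, b) = {x}"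
    and K: "0 \<le> K" "\<And>D. D \<in> index_sets a z b x \<Longrightarrow> part_mat_norm N D (proj_mat a D) \<le> K"
  shows "aubin_constant (param_norm N) N (proj a) (z, b) x K"
proof -
  let ?L = "index_sets a z b x"
  obtain y where y: "\<And>i. a i \<bullet> y < b $ i" using \<open>slater a b\<close> by (auto simp: slater_def)
  \<comment> \<open>The first factor keeps the Slater point strictly feasible, so projections exist;
    the second removes the finitely many closed regions that miss the reference point.\<close>
  define W where "W = (\<Inter>i. {p. a i \<bullet> y < snd p $ i}) \<inter>
    (\<Inter>D\<in>{D. family_independent a D \<and> D \<notin> ?L}. - region a D)"
  have "open W"
    unfolding W_def
    by (intro open_Int open_INT open_Collect_less continuous_intros finite ballI)
      (simp add: closed_region open_Compl)
  moreover have "(z, b) \<in> W"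
    using y region_imp_index_set[OF _ _ x] by (auto simp: W_def)
  ultimately obtain e where e: "e > 0" "ball (z, b) e \<subseteq> W"
    using openE by blast
  define V where "V = ball (z, b) e"
  have cover: "V \<subseteq> (\<Union>D\<in>?L. region a D)"
  proof
    fix p assume "p \<in> V"
    then have p: "p \<in> W" using e by (auto simp: V_def)
    then have "y \<in> feasible a (snd p)" by (auto simp: W_def feasible_def intro: less_imp_le)
    then obtain D where D: "family_independent a D" "p \<in> region a D"
      using region_cover[of a p] by blast
    then have "D \<in> ?L" using p by (auto simp: W_def)
    then show "p \<in> (\<Union>D\<in>?L. region a D)" using D by blast
  qed
  have ind: "family_independent a D" if "D \<in> ?L" for D using that by (simp add: index_sets_def)
  have "dist_to N x2 (proj a p1) \<le> ereal (K * param_norm N (p2 - p1))"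
    if p: "p1 \<in> V" "p2 \<in> V" and x2: "x2 \<in> proj a p2" for p1 p2 x2
  proof -
    obtain D1 D2 where D: "D1 \<in> ?L" "p1 \<in> region a D1" "D2 \<in> ?L" "p2 \<in> region a D2"
      using p cover by blast
    define x1 where "x1 = piece a D1 p1"
    have x1: "proj a p1 = {x1}" using proj_on_region[OF ind] D by (simp add: x1_def)
    have x2': "proj a p2 = {x2}" using proj_on_region[OF ind] D x2 by auto
    have "closed_segment p1 p2 \<subseteq> V"
      using p by (intro closed_segment_subset) (auto simp: V_def)
    then have "N (x2 - x1) \<le> K * param_norm N (p2 - p1)"
      using cover K ind x1 x2' by (intro proj_lipschitz_on_segment[OF N, where \<D> = ?L]) auto
    then show ?thesis by (simp add: dist_to_def x1)
  qed
  moreover have "(z, b) \<in> interior V" using e by (simp add: V_def)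
  ultimately show ?thesis
    unfolding aubin_constant_def using K(1)
    by (intro conjI exI[of _ UNIV] exI[of _ V]) auto
qed

theorem mainTheorem2:
  fixes nrm :: "real ^ 'n \<Rightarrow> real"
    and a :: "'m::finite \<Rightarrow> real ^ 'n"
    and zbar xbar :: "real ^ 'n"
    and bbar :: "real ^ 'm"
  assumes "is_norm nrm"
    and "slater a bbar"
    and "proj a (zbar, bbar) = {xbar}"
  shows "aubin_property (param_norm nrm) nrm (proj a) (zbar, bbar) xbar \<and>
    lip (param_norm nrm) nrm (proj a) (zbar, bbar) xbar =
      ereal (MAX D\<in>index_sets a zbar bbar xbar. part_mat_norm nrm D (proj_mat a D))"
proof -
  let ?L = "index_sets a zbar bbar xbar"
  let ?M = "\<lambda>D. part_mat_norm nrm D (proj_mat a D)"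
  let ?A = "aubin_constant (param_norm nrm) nrm (proj a) (zbar, bbar) xbar"
  define K where "K = (MAX D\<in>?L. ?M D)"
  have F: "xbar \<in> feasible a bbar" using assms(3) by (metis insertI1 mem_proj_iff)
  \<comment> \<open>A member of the family makes the maximum one over a nonempty set and shows that
    it is nonnegative, as an Aubin constant must be.\<close>
  obtain D0 where "family_independent a D0" "(zbar, bbar) \<in> region a D0"
    using region_cover[of a "(zbar, bbar)"] F by auto
  then have D0: "D0 \<in> ?L" using region_imp_index_set assms(3) by blast
  have ub: "?M D \<le> K" if "D \<in> ?L" for D unfolding K_def using that by (intro Max_ge) auto
  have "0 \<le> ?M D0"
    using D0 piece_le_part_mat_norm(2)[OF assms(1)] by (auto simp: index_sets_def)
  then have "0 \<le> K" using ub[OF D0] by linarith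
  then have A: "?A K" using ub by (intro aubin_constant_proj[OF assms])
  have "K \<le> \<kappa>" if "?A \<kappa>" for \<kappa>
    unfolding K_def
    using D0 part_mat_norm_le_aubin_constant[OF assms(1) F _ that] by (intro Max.boundedI) auto
  \<comment> \<open>\<open>K\<close> is itself an Aubin constant and a lower bound for all of them,
    so the infimum is attained at \<open>K\<close>.\<close>
  then have "lip (param_norm nrm) nrm (proj a) (zbar, bbar) xbar = ereal K"
    unfolding lip_def using A by (intro antisym INF_lower INF_greatest) auto
  then show ?thesis using A by (auto simp: aubin_property_def K_def)
qed

end
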